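(* Let $A$ be an evolution $K$-algebra over a field $K$, with natural basis $B=\{e_i\}_{i\in\Lambda}$. If $I$ is a prime ideal of $A$, then $I=I_{H_I}$.
   Context: Algebras are not assumed associative. An evolution algebra over $K$ is a $K$-algebra $A$ having a basis $B=\{e_i\}_{i\in\Lambda}$ (a natural basis) with $e_ie_j=0$ for all $i\ne j$. For an ideal $I$ of $A$, $H_I:=\{e_i\in B: e_i^2\in I\}$. For a set $H\subseteq B$, $I_H:=\bigoplus_{e_i\in H}Ke_i$ is the linear span of $H$ (with $I_\emptyset=0$). An algebra $C$ is prime if for any ideals $J,L$ of $C$ with $JL=0$ one has $J=0$ or $L=0$. A proper ideal $I$ of $A$ is a prime ideal if the quotient $A/I$ is prime. *)

theory Defs
  imports "Jordan_Normal_Form.Missing_VectorSpace" "HOL-Algebra.QuotRing"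
begin

text \<open>
  An algebra over a field is a vector space with a bilinear multiplication, which is not assumed
  to be associative, commutative or unital. It is carried by the record type of modules from
  HOL-Algebra, whose field \<^const>\<open>one\<close> is left unconstrained and never used.
\<close>

locale nonassoc_algebra = vectorspace K A
  for K (structure) and A (structure) +
  assumes mult_closed: "\<lbrakk>x \<in> carrier A; y \<in> carrier A\<rbrakk> \<Longrightarrow> x \<otimes>\<^bsub>A\<^esub> y \<in> carrier A"
    and mult_add_left: "\<lbrakk>x \<in> carrier A; y \<in> carrier A; z \<in> carrier A\<rbrakk>
      \<Longrightarrow> (x \<oplus>\<^bsub>A\<^esub> y) \<otimes>\<^bsub>A\<^esub> z = x \<otimes>\<^bsub>A\<^esub> z \<oplus>\<^bsub>A\<^esub> y \<otimes>\<^bsub>A\<^esub> z"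
    and mult_add_right: "\<lbrakk>x \<in> carrier A; y \<in> carrier A; z \<in> carrier A\<rbrakk>
      \<Longrightarrow> x \<otimes>\<^bsub>A\<^esub> (y \<oplus>\<^bsub>A\<^esub> z) = x \<otimes>\<^bsub>A\<^esub> y \<oplus>\<^bsub>A\<^esub> x \<otimes>\<^bsub>A\<^esub> z"
    and mult_smult_left: "\<lbrakk>c \<in> carrier K; x \<in> carrier A; y \<in> carrier A\<rbrakk>
      \<Longrightarrow> (c \<odot>\<^bsub>A\<^esub> x) \<otimes>\<^bsub>A\<^esub> y = c \<odot>\<^bsub>A\<^esub> (x \<otimes>\<^bsub>A\<^esub> y)"
    and mult_smult_right: "\<lbrakk>c \<in> carrier K; x \<in> carrier A; y \<in> carrier A\<rbrakk>
      \<Longrightarrow> x \<otimes>\<^bsub>A\<^esub> (c \<odot>\<^bsub>A\<^esub> y) = c \<odot>\<^bsub>A\<^esub> (x \<otimes>\<^bsub>A\<^esub> y)"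

text \<open>
  A natural basis is a basis in the algebraic sense (finite linear combinations), of arbitrary
  cardinality. It is given as a set, that is, indexed by itself.
\<close>

locale evolution_algebra = nonassoc_algebra K A
  for K (structure) and A (structure) and B +
  assumes basis_B: "basis B"
    and natural_B: "\<lbrakk>e \<in> B; f \<in> B; e \<noteq> f\<rbrakk> \<Longrightarrow> e \<otimes>\<^bsub>A\<^esub> f = \<zero>\<^bsub>A\<^esub>"

locale algebra_ideal = nonassoc_algebra K A + submodule K I A
  for K (structure) and I and A (structure) +
  assumes ideal_left: "\<lbrakk>a \<in> carrier A; x \<in> I\<rbrakk> \<Longrightarrow> a \<otimes>\<^bsub>A\<^esub> x \<in> I"
    and ideal_right: "\<lbrakk>a \<in> carrier A; x \<in> I\<rbrakk> \<Longrightarrow> x \<otimes>\<^bsub>A\<^esub> a \<in> I"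

definition ideal_product where
  "ideal_product K A J L = module.span K A {x \<otimes>\<^bsub>A\<^esub> y | x y. x \<in> J \<and> y \<in> L}"

definition prime_algebra where
  "prime_algebra K C \<longleftrightarrow> nonassoc_algebra K C \<and>
     (\<forall>J L. algebra_ideal K J C \<longrightarrow> algebra_ideal K L C \<longrightarrow>
        ideal_product K C J L = {\<zero>\<^bsub>C\<^esub>} \<longrightarrow> J = {\<zero>\<^bsub>C\<^esub>} \<or> L = {\<zero>\<^bsub>C\<^esub>})"

text \<open>
  The quotient by an ideal is the factor ring construction \<^const>\<open>FactRing\<close>, which does not need
  associativity, extended by the induced scalar multiplication of cosets.
\<close>

definition quotient_algebra ::
  "('k, 'a, 'm) module_scheme \<Rightarrow> 'a set \<Rightarrow> ('k, 'a set) module" where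
  "quotient_algebra A I = ring.extend (A Quot I)
     (module.fields (\<lambda>c X. \<Union>x\<in>X. I +>\<^bsub>A\<^esub> (c \<odot>\<^bsub>A\<^esub> x)))"

definition prime_algebra_ideal where
  "prime_algebra_ideal K I A \<longleftrightarrow>
     algebra_ideal K I A \<and> I \<noteq> carrier A \<and> prime_algebra K (quotient_algebra A I)"

definition square_in :: "('k, 'a, 'm) module_scheme \<Rightarrow> 'a set \<Rightarrow> 'a set \<Rightarrow> 'a set" where
  "square_in A B I = {e \<in> B. e \<otimes>\<^bsub>A\<^esub> e \<in> I}"

text \<open>The quotient by an ideal is again an algebra.\<close>

lemma quotient_algebra_simps:
  "carrier (quotient_algebra A I) = a_rcosets\<^bsub>A\<^esub> I"
  "mult (quotient_algebra A I) = rcoset_mult A I"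
  "zero (quotient_algebra A I) = I"
  "add (quotient_algebra A I) = set_add A"
  "smult (quotient_algebra A I) c X = (\<Union>x\<in>X. I +>\<^bsub>A\<^esub> (c \<odot>\<^bsub>A\<^esub> x))"
  by (simp_all add: quotient_algebra_def FactRing_def ring.defs module.defs)

context algebra_ideal
begin

lemma ideal_additive_subgroup: "additive_subgroup I A"
proof
  show "I \<subseteq> carrier (add_monoid A)" using subset by simp
  show "x \<otimes>\<^bsub>add_monoid A\<^esub> y \<in> I" if "x \<in> I" "y \<in> I" for x y
    using that by simp
  show "\<one>\<^bsub>add_monoid A\<^esub> \<in> I" by simp
  show "inv\<^bsub>add_monoid A\<^esub> x \<in> I" if "x \<in> I" for x
  proof -
    have x: "x \<in> carrier A" using that subset by auto
    have "(\<ominus>\<^bsub>K\<^esub> \<one>\<^bsub>K\<^esub>) \<odot>\<^bsub>A\<^esub> x = \<ominus>\<^bsub>A\<^esub> x"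
      using x by (simp add: smult_l_minus smult_one)
    moreover have "(\<ominus>\<^bsub>K\<^esub> \<one>\<^bsub>K\<^esub>) \<odot>\<^bsub>A\<^esub> x \<in> I"
      using that by (intro smult_closed) auto
    ultimately show ?thesis by (simp add: a_inv_def)
  qed
qed

sublocale ideal_subgroup: abelian_subgroup I A
  by (intro abelian_subgroupI3 ideal_additive_subgroup M.abelian_group_axioms)

lemma coset_add:
  "\<lbrakk>x \<in> carrier A; y \<in> carrier A\<rbrakk>
    \<Longrightarrow> (I +>\<^bsub>A\<^esub> x) <+>\<^bsub>A\<^esub> (I +>\<^bsub>A\<^esub> y) = I +>\<^bsub>A\<^esub> (x \<oplus>\<^bsub>A\<^esub> y)"
  by (rule ideal_subgroup.a_rcos_sum)

lemma coset_eqI: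
  assumes "h \<in> I" "x \<in> carrier A"
  shows "I +>\<^bsub>A\<^esub> (h \<oplus>\<^bsub>A\<^esub> x) = I +>\<^bsub>A\<^esub> x"
proof -
  have "h \<oplus>\<^bsub>A\<^esub> x \<in> I +>\<^bsub>A\<^esub> x"
    using assms by (auto simp: a_r_coset_def')
  then show ?thesis
    using assms ideal_subgroup.a_repr_independence' by blast
qed

lemma in_cosetD: "z \<in> I +>\<^bsub>A\<^esub> x \<Longrightarrow> \<exists>h\<in>I. z = h \<oplus>\<^bsub>A\<^esub> x"
  by (auto simp: a_r_coset_def')

lemma self_in_coset: "x \<in> carrier A \<Longrightarrow> x \<in> I +>\<^bsub>A\<^esub> x"
  by (rule ideal_subgroup.a_rcos_self)

lemma coset_smult:
  assumes c: "c \<in> carrier K" and x: "x \<in> carrier A"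
  shows "(\<Union>z\<in>I +>\<^bsub>A\<^esub> x. I +>\<^bsub>A\<^esub> (c \<odot>\<^bsub>A\<^esub> z)) = I +>\<^bsub>A\<^esub> (c \<odot>\<^bsub>A\<^esub> x)"
proof -
  have "I +>\<^bsub>A\<^esub> (c \<odot>\<^bsub>A\<^esub> z) = I +>\<^bsub>A\<^esub> (c \<odot>\<^bsub>A\<^esub> x)" if z: "z \<in> I +>\<^bsub>A\<^esub> x" for z
  proof -
    obtain h where h: "h \<in> I" "z = h \<oplus>\<^bsub>A\<^esub> x" using in_cosetD[OF z] by auto
    have hA: "h \<in> carrier A" using h subset by auto
    have "c \<odot>\<^bsub>A\<^esub> z = c \<odot>\<^bsub>A\<^esub> h \<oplus>\<^bsub>A\<^esub> c \<odot>\<^bsub>A\<^esub> x"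
      using c x h hA by (simp add: smult_r_distr)
    then show ?thesis
      using coset_eqI[of "c \<odot>\<^bsub>A\<^esub> h" "c \<odot>\<^bsub>A\<^esub> x"] c x h by simp
  qed
  then show ?thesis using self_in_coset[OF x] by blast
qed

lemma coset_mult:
  assumes x: "x \<in> carrier A" and y: "y \<in> carrier A"
  shows "rcoset_mult A I (I +>\<^bsub>A\<^esub> x) (I +>\<^bsub>A\<^esub> y) = I +>\<^bsub>A\<^esub> (x \<otimes>\<^bsub>A\<^esub> y)"
proof -
  have *: "I +>\<^bsub>A\<^esub> (a \<otimes>\<^bsub>A\<^esub> b) = I +>\<^bsub>A\<^esub> (x \<otimes>\<^bsub>A\<^esub> y)"
    if a: "a \<in> I +>\<^bsub>A\<^esub> x" and b: "b \<in> I +>\<^bsub>A\<^esub> y" for a b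
  proof -
    obtain h where h: "h \<in> I" "a = h \<oplus>\<^bsub>A\<^esub> x" using in_cosetD[OF a] by auto
    obtain k where k: "k \<in> I" "b = k \<oplus>\<^bsub>A\<^esub> y" using in_cosetD[OF b] by auto
    have hk: "h \<in> carrier A" "k \<in> carrier A" using h k subset by auto
    have b_car: "b \<in> carrier A" using hk k y by simp
    have "a \<otimes>\<^bsub>A\<^esub> b = h \<otimes>\<^bsub>A\<^esub> b \<oplus>\<^bsub>A\<^esub> (x \<otimes>\<^bsub>A\<^esub> k \<oplus>\<^bsub>A\<^esub> x \<otimes>\<^bsub>A\<^esub> y)"
      using h k hk x y b_car
      by (metis mult_add_left mult_add_right M.add.m_closed)
    moreover have "h \<otimes>\<^bsub>A\<^esub> b \<in> I" "x \<otimes>\<^bsub>A\<^esub> k \<in> I"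
      using h k b_car x by (auto intro: ideal_left ideal_right)
    ultimately show ?thesis
      using x y hk by (simp add: coset_eqI mult_closed)
  qed
  show ?thesis unfolding rcoset_mult_def
    using * self_in_coset[OF x] self_in_coset[OF y] by blast
qed

lemma quotient_carrier: "carrier (quotient_algebra A I) = (\<lambda>x. I +>\<^bsub>A\<^esub> x) ` carrier A"
  by (auto simp: quotient_algebra_simps A_RCOSETS_def' a_r_coset_def')

lemma quotient_ops:
  "\<lbrakk>x \<in> carrier A; y \<in> carrier A\<rbrakk> \<Longrightarrow>
    (I +>\<^bsub>A\<^esub> x) \<oplus>\<^bsub>quotient_algebra A I\<^esub> (I +>\<^bsub>A\<^esub> y) = I +>\<^bsub>A\<^esub> (x \<oplus>\<^bsub>A\<^esub> y)"
  "\<lbrakk>x \<in> carrier A; y \<in> carrier A\<rbrakk> \<Longrightarrow>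
    (I +>\<^bsub>A\<^esub> x) \<otimes>\<^bsub>quotient_algebra A I\<^esub> (I +>\<^bsub>A\<^esub> y) = I +>\<^bsub>A\<^esub> (x \<otimes>\<^bsub>A\<^esub> y)"
  "\<lbrakk>c \<in> carrier K; x \<in> carrier A\<rbrakk> \<Longrightarrow>
    c \<odot>\<^bsub>quotient_algebra A I\<^esub> (I +>\<^bsub>A\<^esub> x) = I +>\<^bsub>A\<^esub> (c \<odot>\<^bsub>A\<^esub> x)"
  by (simp_all only: quotient_algebra_simps coset_add coset_mult coset_smult)

lemma quotient_abelian_group: "abelian_group (quotient_algebra A I)"
proof -
  have zero: "\<zero>\<^bsub>quotient_algebra A I\<^esub> = I +>\<^bsub>A\<^esub> \<zero>\<^bsub>A\<^esub>"
    using subset by (simp add: quotient_algebra_simps M.a_coset_add_zero)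
  show ?thesis
  proof (rule abelian_groupI)
    fix X assume "X \<in> carrier (quotient_algebra A I)"
    then obtain x where x: "x \<in> carrier A" "X = I +>\<^bsub>A\<^esub> x" by (auto simp: quotient_carrier)
    then show "\<exists>Y\<in>carrier (quotient_algebra A I).
        Y \<oplus>\<^bsub>quotient_algebra A I\<^esub> X = \<zero>\<^bsub>quotient_algebra A I\<^esub>"
      by (intro bexI[of _ "I +>\<^bsub>A\<^esub> (\<ominus>\<^bsub>A\<^esub> x)"])
        (auto simp: quotient_carrier quotient_ops zero M.l_neg)
  qed (auto simp: quotient_carrier quotient_ops zero M.a_ac)
qed

lemma quotient_nonassoc_algebra: "nonassoc_algebra K (quotient_algebra A I)"
proof -
  have "module K (quotient_algebra A I)"
    by (rule moduleI[OF R.is_cring quotient_abelian_group])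
      (auto simp: quotient_carrier quotient_ops smult_l_distr smult_r_distr smult_assoc1)
  moreover have "nonassoc_algebra_axioms K (quotient_algebra A I)"
    by unfold_locales
      (auto simp: quotient_carrier quotient_ops
         mult_closed mult_add_left mult_add_right mult_smult_left mult_smult_right)
  ultimately show ?thesis
    by (intro nonassoc_algebra.intro vectorspace.intro) (auto intro: field_axioms)
qed

end

end

theory Submission
  imports Defs
begin

text \<open>
  Write \<open>H\<close> for \<^term>\<open>square_in A B I\<close>. Multiplying \<open>x = \<Sum>\<^sub>i a\<^sub>i e\<^sub>i\<close> by a natural basis vector isolates
  one coefficient: \<open>x e\<^sub>i = e\<^sub>i x = a\<^sub>i e\<^sub>i\<^sup>2\<close>. Both inclusions rest on this identity.

  If \<open>x \<in> I\<close> then \<open>a\<^sub>i e\<^sub>i\<^sup>2 \<in> I\<close>, so \<open>e\<^sub>i \<in> H\<close> whenever \<open>a\<^sub>i \<noteq> 0\<close>. Hence every ideal is contained in the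
  span of \<open>H\<close> (\<open>ideal_subset_span_square_in\<close>).

  If \<open>e \<in> H\<close> then \<open>A e\<close> and \<open>e A\<close> consist of multiples of \<open>e\<^sup>2\<close> and so lie in \<open>I\<close>. Therefore
  \<open>J = I + K e\<close> is an ideal (\<open>ideal_adjoin_natural\<close>) with \<open>J J \<subseteq> I\<close>, and primality of \<open>I\<close>, pulled back
  from the quotient to ideals of \<open>A\<close> (\<open>prime_algebra_ideal_product\<close>), gives \<open>J \<subseteq> I\<close>, hence
  \<open>e \<in> I\<close> (\<open>square_in_prime_subset\<close>).
\<close>

section \<open>Prime ideals\<close>

context nonassoc_algebra
begin

lemma zero_mult: "x \<in> carrier A \<Longrightarrow> \<zero>\<^bsub>A\<^esub> \<otimes>\<^bsub>A\<^esub> x = \<zero>\<^bsub>A\<^esub>"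
  using mult_smult_left[of "\<zero>\<^bsub>K\<^esub>" "\<zero>\<^bsub>A\<^esub>" x] by (simp add: mult_closed)

lemma mult_zero: "x \<in> carrier A \<Longrightarrow> x \<otimes>\<^bsub>A\<^esub> \<zero>\<^bsub>A\<^esub> = \<zero>\<^bsub>A\<^esub>"
  using mult_smult_right[of "\<zero>\<^bsub>K\<^esub>" x "\<zero>\<^bsub>A\<^esub>"] by (simp add: mult_closed)

end

context algebra_ideal
begin

lemma coset_eq_ideal_iff:
  assumes "x \<in> carrier A"
  shows "I +>\<^bsub>A\<^esub> x = I \<longleftrightarrow> x \<in> I"
proof
  show "x \<in> I" if "I +>\<^bsub>A\<^esub> x = I"
    using self_in_coset[OF assms] that by simp
  show "I +>\<^bsub>A\<^esub> x = I" if "x \<in> I"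
    using coset_eqI[OF that, of "\<zero>\<^bsub>A\<^esub>"] assms subset by (simp add: M.a_coset_add_zero)
qed

lemma image_in_quotient_is_ideal:
  assumes "algebra_ideal K J A"
  shows "algebra_ideal K ((\<lambda>x. I +>\<^bsub>A\<^esub> x) ` J) (quotient_algebra A I)"
proof -
  interpret J: algebra_ideal K J A by fact
  interpret Q: nonassoc_algebra K "quotient_algebra A I" by (rule quotient_nonassoc_algebra)
  have J_car: "x \<in> carrier A" if "x \<in> J" for x using that J.subset by auto
  have zero: "\<zero>\<^bsub>quotient_algebra A I\<^esub> = I +>\<^bsub>A\<^esub> \<zero>\<^bsub>A\<^esub>"
    using coset_eq_ideal_iff[of "\<zero>\<^bsub>A\<^esub>"] by (simp add: quotient_algebra_simps)
  have "submodule K ((\<lambda>x. I +>\<^bsub>A\<^esub> x) ` J) (quotient_algebra A I)"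
    by unfold_locales (auto simp: quotient_carrier quotient_ops J_car zero)
  moreover have "algebra_ideal_axioms ((\<lambda>x. I +>\<^bsub>A\<^esub> x) ` J) (quotient_algebra A I)"
    by unfold_locales
      (auto simp: quotient_carrier quotient_ops J_car intro: J.ideal_left J.ideal_right)
  ultimately show ?thesis
    by (intro algebra_ideal.intro quotient_nonassoc_algebra)
qed

end

text \<open>
  Pulling primality back from the quotient to \<open>A\<close>. The images of \<open>J\<close> and \<open>L\<close> in the quotient are ideals with
  zero product, so one of them is zero, and an ideal has zero image exactly when it lies in \<open>I\<close>.
\<close>

lemma prime_algebra_ideal_product:
  assumes prime: "prime_algebra_ideal K I A"
    and J: "algebra_ideal K J A" and L: "algebra_ideal K L A"
    and prod: "\<And>x y. \<lbrakk>x \<in> J; y \<in> L\<rbrakk> \<Longrightarrow> x \<otimes>\<^bsub>A\<^esub> y \<in> I"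
  shows "J \<subseteq> I \<or> L \<subseteq> I"
proof -
  interpret algebra_ideal K I A using prime by (simp add: prime_algebra_ideal_def)
  interpret J: algebra_ideal K J A by fact
  interpret L: algebra_ideal K L A by fact
  let ?Q = "quotient_algebra A I" and ?\<pi> = "\<lambda>x. I +>\<^bsub>A\<^esub> x"
  interpret Q: nonassoc_algebra K ?Q by (rule quotient_nonassoc_algebra)
  have J_car: "x \<in> carrier A" if "x \<in> J" for x using that J.subset by auto
  have L_car: "x \<in> carrier A" if "x \<in> L" for x using that L.subset by auto
  have zero: "\<zero>\<^bsub>?Q\<^esub> = I" by (simp add: quotient_algebra_simps)
  have "?\<pi> x \<otimes>\<^bsub>?Q\<^esub> ?\<pi> y = \<zero>\<^bsub>?Q\<^esub>" if x: "x \<in> J" and y: "y \<in> L" for x y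
  proof -
    have "x \<otimes>\<^bsub>A\<^esub> y \<in> carrier A" by (intro mult_closed J_car L_car x y)
    then have "?\<pi> (x \<otimes>\<^bsub>A\<^esub> y) = I"
      using prod[OF x y] by (rule coset_eq_ideal_iff[THEN iffD2])
    then show ?thesis
      unfolding zero quotient_ops(2)[OF J_car[OF x] L_car[OF y]] .
  qed
  then have "{X \<otimes>\<^bsub>?Q\<^esub> Y | X Y. X \<in> ?\<pi> ` J \<and> Y \<in> ?\<pi> ` L} \<subseteq> {\<zero>\<^bsub>?Q\<^esub>}"
    by blast
  moreover have "submodule K {\<zero>\<^bsub>?Q\<^esub>} ?Q"
    by unfold_locales auto
  ultimately have "ideal_product K ?Q (?\<pi> ` J) (?\<pi> ` L) \<subseteq> {\<zero>\<^bsub>?Q\<^esub>}"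
    unfolding ideal_product_def by (rule Q.span_is_subset)
  moreover have "\<zero>\<^bsub>?Q\<^esub> \<in> ideal_product K ?Q (?\<pi> ` J) (?\<pi> ` L)"
    unfolding ideal_product_def by (rule Q.span_zero)
  ultimately have "ideal_product K ?Q (?\<pi> ` J) (?\<pi> ` L) = {\<zero>\<^bsub>?Q\<^esub>}" by blast
  moreover have "algebra_ideal K (?\<pi> ` J) ?Q" "algebra_ideal K (?\<pi> ` L) ?Q"
    by (rule image_in_quotient_is_ideal[OF J], rule image_in_quotient_is_ideal[OF L])
  ultimately have "?\<pi> ` J = {\<zero>\<^bsub>?Q\<^esub>} \<or> ?\<pi> ` L = {\<zero>\<^bsub>?Q\<^esub>}"
    using prime unfolding prime_algebra_ideal_def prime_algebra_def by blast
  moreover have "S \<subseteq> I" if S: "?\<pi> ` S = {\<zero>\<^bsub>?Q\<^esub>}" "S \<subseteq> carrier A" for S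
  proof
    fix x assume x: "x \<in> S"
    then have "?\<pi> x = I" using S(1) unfolding zero by blast
    then show "x \<in> I" using coset_eq_ideal_iff x S(2) by (metis subsetD)
  qed
  ultimately show ?thesis
    using J.subset L.subset by metis
qed

section \<open>Multiplication by natural basis vectors\<close>

context evolution_algebra
begin

lemma B_subset_carrier: "B \<subseteq> carrier A"
  using basis_B by (simp add: basis_def)

text \<open>
  The coefficients are taken nonzero so that the square of each basis vector of the support can be
  recovered by dividing by its coefficient.
\<close>

lemma natural_basis_expansion:
  assumes "x \<in> carrier A"
  obtains a F where "finite F" "F \<subseteq> B" "a \<in> F \<rightarrow> carrier K" "\<And>f. f \<in> F \<Longrightarrow> a f \<noteq> \<zero>\<^bsub>K\<^esub>"
    "x = lincomb a F"
proof -
  have "x \<in> span B" using assms basis_B by (simp add: basis_def)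
  then obtain a G where G: "finite G" "G \<subseteq> B" "a \<in> G \<rightarrow> carrier K" "x = lincomb a G"
    by (auto simp: span_def)
  define F where "F = {f \<in> G. a f \<noteq> \<zero>\<^bsub>K\<^esub>}"
  have "lincomb a F = lincomb a G"
    unfolding lincomb_def
    by (rule M.add.finprod_mono_neutral_cong_left)
      (use G B_subset_carrier in \<open>auto simp: F_def intro!: smult_closed\<close>)
  then show thesis
    using G by (intro that[of F a]) (auto simp: F_def)
qed

text \<open>
  The elements annihilated by \<open>e\<close> on both sides form a subspace, and it contains every other
  natural basis vector; this replaces an induction over the linear combination.
\<close>

lemma lincomb_mult_outside:
  assumes "e \<in> B" "F \<subseteq> B - {e}" "finite F" "a \<in> F \<rightarrow> carrier K"
  shows "lincomb a F \<otimes>\<^bsub>A\<^esub> e = \<zero>\<^bsub>A\<^esub>" and "e \<otimes>\<^bsub>A\<^esub> lincomb a F = \<zero>\<^bsub>A\<^esub>"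
proof -
  let ?N = "{y \<in> carrier A. y \<otimes>\<^bsub>A\<^esub> e = \<zero>\<^bsub>A\<^esub> \<and> e \<otimes>\<^bsub>A\<^esub> y = \<zero>\<^bsub>A\<^esub>}"
  have e: "e \<in> carrier A" using assms B_subset_carrier by auto
  have "F \<subseteq> ?N" using assms B_subset_carrier by (auto intro!: natural_B)
  moreover have "submodule K ?N A"
    by unfold_locales
      (auto simp: e mult_add_left mult_add_right mult_smult_left mult_smult_right
        zero_mult mult_zero)
  ultimately have "span F \<subseteq> ?N" by (rule span_is_subset)
  moreover have "lincomb a F \<in> span F" using assms by (auto simp: span_def)
  ultimately show "lincomb a F \<otimes>\<^bsub>A\<^esub> e = \<zero>\<^bsub>A\<^esub>" "e \<otimes>\<^bsub>A\<^esub> lincomb a F = \<zero>\<^bsub>A\<^esub>" by auto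
qed

lemma lincomb_mult_natural:
  assumes "e \<in> F" "F \<subseteq> B" "finite F" "a \<in> F \<rightarrow> carrier K"
  shows "lincomb a F \<otimes>\<^bsub>A\<^esub> e = a e \<odot>\<^bsub>A\<^esub> (e \<otimes>\<^bsub>A\<^esub> e)"
    and "e \<otimes>\<^bsub>A\<^esub> lincomb a F = a e \<odot>\<^bsub>A\<^esub> (e \<otimes>\<^bsub>A\<^esub> e)"
proof -
  have car: "e \<in> carrier A" "a e \<in> carrier K" "F \<subseteq> carrier A"
    using assms B_subset_carrier by auto
  have rest: "lincomb a (F - {e}) \<in> carrier A"
    using assms car by (intro lincomb_closed) auto
  have split: "lincomb a F = a e \<odot>\<^bsub>A\<^esub> e \<oplus>\<^bsub>A\<^esub> lincomb a (F - {e})"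
    using assms car by (intro lincomb_del2)
  have "lincomb a (F - {e}) \<otimes>\<^bsub>A\<^esub> e = \<zero>\<^bsub>A\<^esub>" "e \<otimes>\<^bsub>A\<^esub> lincomb a (F - {e}) = \<zero>\<^bsub>A\<^esub>"
    using assms by (auto intro!: lincomb_mult_outside)
  then show "lincomb a F \<otimes>\<^bsub>A\<^esub> e = a e \<odot>\<^bsub>A\<^esub> (e \<otimes>\<^bsub>A\<^esub> e)"
    and "e \<otimes>\<^bsub>A\<^esub> lincomb a F = a e \<odot>\<^bsub>A\<^esub> (e \<otimes>\<^bsub>A\<^esub> e)"
    using car rest
    by (simp_all add: split mult_add_left mult_add_right mult_smult_left mult_smult_right mult_closed)
qed

lemma mult_natural_in_square_multiples:
  assumes e: "e \<in> B" and x: "x \<in> carrier A"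
  shows "\<exists>c\<in>carrier K. x \<otimes>\<^bsub>A\<^esub> e = c \<odot>\<^bsub>A\<^esub> (e \<otimes>\<^bsub>A\<^esub> e) \<and> e \<otimes>\<^bsub>A\<^esub> x = c \<odot>\<^bsub>A\<^esub> (e \<otimes>\<^bsub>A\<^esub> e)"
proof -
  obtain a F where F: "finite F" "F \<subseteq> B" "a \<in> F \<rightarrow> carrier K" "x = lincomb a F"
    using x by (rule natural_basis_expansion)
  show ?thesis
  proof (cases "e \<in> F")
    case True
    then show ?thesis using lincomb_mult_natural[OF _ F(2,1,3)] F by blast
  next
    case False
    then have "F \<subseteq> B - {e}" using F by auto
    then show ?thesis
      using lincomb_mult_outside[OF e _ F(1,3)] F e B_subset_carrier
      by (intro bexI[of _ "\<zero>\<^bsub>K\<^esub>"]) (auto simp: mult_closed)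
  qed
qed

section \<open>Basis vectors whose square lies in an ideal\<close>

text \<open>
  This is stronger than \<open>I + K e\<close> being an ideal: its products with all of \<open>A\<close> already fall into \<open>I\<close>.
  The same fact therefore also gives \<open>(I + K e) (I + K e) \<subseteq> I\<close>.
\<close>

lemma mult_adjoin_natural_in_ideal:
  assumes I: "algebra_ideal K I A" and e: "e \<in> square_in A B I"
    and h: "h \<in> I" and c: "c \<in> carrier K" and x: "x \<in> carrier A"
  shows "x \<otimes>\<^bsub>A\<^esub> (h \<oplus>\<^bsub>A\<^esub> c \<odot>\<^bsub>A\<^esub> e) \<in> I" and "(h \<oplus>\<^bsub>A\<^esub> c \<odot>\<^bsub>A\<^esub> e) \<otimes>\<^bsub>A\<^esub> x \<in> I"
proof -
  interpret I: algebra_ideal K I A by fact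
  have eB: "e \<in> B" and sq: "e \<otimes>\<^bsub>A\<^esub> e \<in> I" using e by (auto simp: square_in_def)
  have car: "e \<in> carrier A" "h \<in> carrier A" using eB B_subset_carrier h I.subset by auto
  have "x \<otimes>\<^bsub>A\<^esub> e \<in> I" "e \<otimes>\<^bsub>A\<^esub> x \<in> I"
    using mult_natural_in_square_multiples[OF eB x] sq by auto
  then show "x \<otimes>\<^bsub>A\<^esub> (h \<oplus>\<^bsub>A\<^esub> c \<odot>\<^bsub>A\<^esub> e) \<in> I" "(h \<oplus>\<^bsub>A\<^esub> c \<odot>\<^bsub>A\<^esub> e) \<otimes>\<^bsub>A\<^esub> x \<in> I"
    using h c x car
    by (simp_all add: mult_add_left mult_add_right mult_smult_left mult_smult_right
        I.ideal_left I.ideal_right)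
qed

lemma ideal_adjoin_natural:
  assumes I: "algebra_ideal K I A" and e: "e \<in> square_in A B I"
  shows "algebra_ideal K {h \<oplus>\<^bsub>A\<^esub> c \<odot>\<^bsub>A\<^esub> e | h c. h \<in> I \<and> c \<in> carrier K} A"
    (is "algebra_ideal K ?J A")
proof -
  interpret I: algebra_ideal K I A by fact
  have eA: "e \<in> carrier A" using e B_subset_carrier by (auto simp: square_in_def)
  have I_car: "h \<in> carrier A" if "h \<in> I" for h using that I.subset by auto
  have I_sub: "h \<in> ?J" if "h \<in> I" for h
    using that eA I_car by (auto intro!: exI[of _ h] exI[of _ "\<zero>\<^bsub>K\<^esub>"])
  have "submodule K ?J A"
  proof (unfold_locales, goal_cases)
    case 1
    then show ?case using I_car eA by auto
  next
    case (2 v w)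
    then obtain h c k d where *: "v = h \<oplus>\<^bsub>A\<^esub> c \<odot>\<^bsub>A\<^esub> e" "w = k \<oplus>\<^bsub>A\<^esub> d \<odot>\<^bsub>A\<^esub> e"
      "h \<in> I" "k \<in> I" "c \<in> carrier K" "d \<in> carrier K" by blast
    then have "v \<oplus>\<^bsub>A\<^esub> w = (h \<oplus>\<^bsub>A\<^esub> k) \<oplus>\<^bsub>A\<^esub> (c \<oplus>\<^bsub>K\<^esub> d) \<odot>\<^bsub>A\<^esub> e"
      using eA I_car by (simp add: smult_l_distr M.a_ac)
    then show ?case using * by blast
  next
    case 3
    then show ?case by (rule I_sub) simp
  next
    case (4 b v)
    then obtain h c where *: "v = h \<oplus>\<^bsub>A\<^esub> c \<odot>\<^bsub>A\<^esub> e" "h \<in> I" "c \<in> carrier K" by blast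
    then have "b \<odot>\<^bsub>A\<^esub> v = b \<odot>\<^bsub>A\<^esub> h \<oplus>\<^bsub>A\<^esub> (b \<otimes>\<^bsub>K\<^esub> c) \<odot>\<^bsub>A\<^esub> e"
      using eA I_car 4 by (simp add: smult_r_distr smult_assoc1)
    then show ?case using * 4 by blast
  qed
  then show "algebra_ideal K ?J A"
    using mult_adjoin_natural_in_ideal[OF I e] I_sub
    by (intro algebra_ideal.intro algebra_ideal_axioms.intro nonassoc_algebra_axioms) blast+
qed

text \<open>Primality is applied to the ideal \<open>I + K e\<close> paired with itself.\<close>

lemma square_in_prime_subset:
  assumes prime: "prime_algebra_ideal K I A"
  shows "square_in A B I \<subseteq> I"
proof
  fix e assume e: "e \<in> square_in A B I"
  have I: "algebra_ideal K I A" using prime by (simp add: prime_algebra_ideal_def)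
  interpret I: algebra_ideal K I A by fact
  let ?J = "{h \<oplus>\<^bsub>A\<^esub> c \<odot>\<^bsub>A\<^esub> e | h c. h \<in> I \<and> c \<in> carrier K}"
  have eA: "e \<in> carrier A" using e B_subset_carrier by (auto simp: square_in_def)
  interpret J: algebra_ideal K ?J A by (rule ideal_adjoin_natural[OF I e])
  have "?J \<subseteq> I \<or> ?J \<subseteq> I"
  proof (rule prime_algebra_ideal_product[OF prime])
    show "x \<otimes>\<^bsub>A\<^esub> y \<in> I" if "x \<in> ?J" "y \<in> ?J" for x y
      using that J.subset mult_adjoin_natural_in_ideal(1)[OF I e] by blast
  qed (rule J.algebra_ideal_axioms)+
  moreover have "e \<in> ?J"
    using eA by (auto intro!: exI[of _ "\<zero>\<^bsub>A\<^esub>"] exI[of _ "\<one>\<^bsub>K\<^esub>"] simp: smult_one)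
  ultimately show "e \<in> I" by blast
qed

text \<open>
  Multiplying \<open>x \<in> I\<close> by a basis vector \<open>f\<close> of its support gives \<open>f\<^sup>2\<close> times a nonzero scalar inside \<open>I\<close>;
  since the scalars form a field, \<open>f\<^sup>2\<close> itself lies in \<open>I\<close>.
\<close>

lemma ideal_subset_span_square_in:
  assumes "algebra_ideal K I A"
  shows "I \<subseteq> span (square_in A B I)"
proof
  interpret I: algebra_ideal K I A by fact
  fix x assume x: "x \<in> I"
  then have "x \<in> carrier A" using I.subset by auto
  then obtain a F where F: "finite F" "F \<subseteq> B" "a \<in> F \<rightarrow> carrier K"
    and nz: "\<And>f. f \<in> F \<Longrightarrow> a f \<noteq> \<zero>\<^bsub>K\<^esub>" and x_eq: "x = lincomb a F"
    by (rule natural_basis_expansion) blast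
  have "f \<in> square_in A B I" if f: "f \<in> F" for f
  proof -
    have fA: "f \<in> carrier A" "a f \<in> carrier K" and fB: "f \<in> B"
      using f F B_subset_carrier by auto
    have unit: "a f \<in> Units K" using fA nz[OF f] by (simp add: field_Units)
    have "x \<otimes>\<^bsub>A\<^esub> f \<in> I" using x fA by (intro I.ideal_right)
    then have "a f \<odot>\<^bsub>A\<^esub> (f \<otimes>\<^bsub>A\<^esub> f) \<in> I"
      using lincomb_mult_natural[OF f F(2,1,3)] x_eq by simp
    then have "inv\<^bsub>K\<^esub> (a f) \<odot>\<^bsub>A\<^esub> (a f \<odot>\<^bsub>A\<^esub> (f \<otimes>\<^bsub>A\<^esub> f)) \<in> I"
      by (rule I.smult_closed[OF R.Units_inv_closed[OF unit]])
    also have "inv\<^bsub>K\<^esub> (a f) \<odot>\<^bsub>A\<^esub> (a f \<odot>\<^bsub>A\<^esub> (f \<otimes>\<^bsub>A\<^esub> f)) = f \<otimes>\<^bsub>A\<^esub> f"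
      using unit fA by (simp add: smult_assoc1[symmetric] mult_closed smult_one)
    finally show ?thesis using fB by (simp add: square_in_def)
  qed
  then show "x \<in> span (square_in A B I)"
    using F x_eq by (auto simp: span_def)
qed

end

theorem proposition3p19:
  fixes K :: "('k, 'm) ring_scheme"
    and A :: "('k, 'a, 'n) module_scheme"
    and B I :: "'a set"
  assumes "evolution_algebra K A B"
    and "prime_algebra_ideal K I A"
  shows "I = module.span K A (square_in A B I)"
proof -
  interpret evolution_algebra K A B by fact
  interpret I: algebra_ideal K I A using assms(2) by (simp add: prime_algebra_ideal_def)
  show ?thesis
  proof
    show "I \<subseteq> span (square_in A B I)"
      by (rule ideal_subset_span_square_in) (rule I.algebra_ideal_axioms)
    show "span (square_in A B I) \<subseteq> I"
      using square_in_prime_subset[OF assms(2)] I.submodule_axioms by (rule span_is_subset)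
  qed
qed

end
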